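(* Let $n\geq 10$. In PAP on $S_n$ with pattern length $k=4$, the move-by-move reverse strategy is a winning strategy for Player II. Consequently $\operatorname{sg}(S_n,4)=0$.
   Context: $S_n$ is the set of permutations of $\{1,\dots,n\}$ in one-line notation; for $\pi=\pi(1)\cdots\pi(n)$ the reverse is $\pi^r=\pi(n)\cdots\pi(1)$. A permutation $\pi$ contains a pattern $p\in S_k$ if some subsequence $\pi(i_1)\cdots\pi(i_k)$ with $i_1<\cdots<i_k$ is order-isomorphic to $p$; otherwise it avoids $p$. The impartial game PAP with pattern length $k$: a position is a subset $X\subseteq S_n$; a move consists of choosing a pattern $p\in S_k$ contained in at least one permutation of $X$, and replacing $X$ by the permutations of $X$ avoiding $p$. Normal play: a player with no legal move loses. Play starts from $X=S_n$, Player I moving first. The move-by-move reverse strategy for Player II: whenever Player I chooses a pattern $p$, Player II replies by choosing $p^r$. It is a winning strategy if, against every sequence of legal moves by Player I, each such reply $p^r$ is a legal move, so that Player II always makes the last move. The Sprague--Grundy value is $\operatorname{sg}(X)=\operatorname{mex}\{\operatorname{sg}(Y): Y \text{ reachable from } X \text{ in one move}\}$ (terminal positions have value $0$), and $\operatorname{sg}(S_n,k)$ denotes the value of the starting position $S_n$ in PAP with pattern length $k$. *)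

theory Defs
  imports "HOL-Combinatorics.Multiset_Permutations" "HOL-Library.Sublist"
begin

text \<open>Permutations of \<open>{1..n}\<close> are lists in one-line notation; the reverse of a permutation is
  \<^const>\<open>rev\<close>.\<close>

abbreviation perms :: "nat \<Rightarrow> nat list set" where
  "perms n \<equiv> permutations_of_set {1..n}"

definition order_isomorphic :: "nat list \<Rightarrow> nat list \<Rightarrow> bool" where
  "order_isomorphic xs ys \<longleftrightarrow>
     length xs = length ys \<and>
     (\<forall>i<length xs. \<forall>j<length xs. xs ! i < xs ! j \<longleftrightarrow> ys ! i < ys ! j)"

definition contains :: "nat list \<Rightarrow> nat list \<Rightarrow> bool" where
  "contains \<pi> p \<longleftrightarrow> (\<exists>xs. subseq xs \<pi> \<and> order_isomorphic xs p)"

abbreviation avoids :: "nat list \<Rightarrow> nat list \<Rightarrow> bool" where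
  "avoids \<pi> p \<equiv> \<not> contains \<pi> p"

definition legal_moves :: "nat \<Rightarrow> nat list set \<Rightarrow> nat list set" where
  "legal_moves k X = {p \<in> perms k. \<exists>\<pi>\<in>X. contains \<pi> p}"

definition move :: "nat list set \<Rightarrow> nat list \<Rightarrow> nat list set" where
  "move X p = {\<pi> \<in> X. avoids \<pi> p}"

text \<open>A list of moves is read in the order in which the two players make them, alternately and
  starting with Player I.\<close>

fun legal_play :: "nat \<Rightarrow> nat list set \<Rightarrow> nat list list \<Rightarrow> bool" where
  "legal_play k X [] \<longleftrightarrow> True"
| "legal_play k X (p # ps) \<longleftrightarrow> p \<in> legal_moves k X \<and> legal_play k (move X p) ps"

text \<open>The play in which Player I chooses the patterns \<open>ps\<close> and Player II answers each of them
  immediately with its reverse.\<close>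

definition with_reverse_replies :: "nat list list \<Rightarrow> nat list list" where
  "with_reverse_replies ps = concat (map (\<lambda>p. [p, rev p]) ps)"

definition reverse_strategy_winning :: "nat \<Rightarrow> nat list set \<Rightarrow> bool" where
  "reverse_strategy_winning k X \<longleftrightarrow>
     (\<forall>ps p. legal_play k X (with_reverse_replies ps @ [p]) \<longrightarrow>
             legal_play k X (with_reverse_replies ps @ [p, rev p]))"

definition mex :: "nat set \<Rightarrow> nat" where
  "mex A = (LEAST m. m \<notin> A)"

lemma finite_legal_moves: "finite (legal_moves k X)"
  unfolding legal_moves_def by simp

lemma card_legal_moves_move_less:
  assumes "p \<in> legal_moves k X"
  shows "card (legal_moves k (move X p)) < card (legal_moves k X)"
proof (rule psubset_card_mono)
  show "legal_moves k (move X p) \<subset> legal_moves k X"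
    using assms unfolding legal_moves_def move_def by blast
qed (rule finite_legal_moves)

text \<open>Only finitely many patterns exist and none can be chosen twice, so the recursion terminates
  for every set \<open>X\<close>, finite or not.\<close>

function sg :: "nat \<Rightarrow> nat list set \<Rightarrow> nat" where
  "sg k X = mex ((\<lambda>p. sg k (move X p)) ` legal_moves k X)"
  by pat_completeness auto
termination
  by (relation "measure (\<lambda>(k, X). card (legal_moves k X))")
     (auto intro: card_legal_moves_move_less)

declare sg.simps [simp del]

text \<open>Every legal play is finite, of length at most the number of patterns. Hence if all reverse
  replies are legal, the player who is eventually left without a move is Player I.\<close>

lemma length_legal_play: "legal_play k X ps \<Longrightarrow> length ps \<le> card (legal_moves k X)"
proof (induction ps arbitrary: X)
  case (Cons p ps)
  then have "length ps \<le> card (legal_moves k (move X p))" by simp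
  also have "\<dots> < card (legal_moves k X)"
    using Cons.prems by (auto intro: card_legal_moves_move_less)
  finally show ?case by simp
qed simp

end

theory Submission
  imports Defs
begin

text \<open>
  After some rounds the chosen patterns form a set closed under reversal, and we need, for every
  legal pattern \<open>p\<close>, a permutation of the position that contains exactly one of \<open>p\<close> and \<open>rev p\<close>;
  up to reversing it, it shows that the reply \<open>rev p\<close> is legal. Since \<open>n > 9\<close>, Erdos--Szekeres
  gives that the monotone patterns have not been chosen as long as the position is nonempty.
  Let \<open>\<pi>\<close> be a permutation of the position that contains \<open>p\<close>. Enlarging an occurrence of \<open>p\<close> in
  \<open>\<pi>\<close> by three more entries, one at a time, a finite search shows that the patterns of \<open>\<pi>\<close> and the
  monotone ones always include, up to reversal, all patterns of one of a few small
  permutations in which a single entry is inflated to an increasing run. The length of the run does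
  not influence the set of patterns once it is at least 4, so inflating to length \<open>n\<close> yields a member
  of the position, and each inflation used contains exactly one of \<open>p\<close> and \<open>rev p\<close>.
\<close>

section \<open>Order isomorphism and containment\<close>

lemma order_isomorphic_map:
  assumes "strict_mono_on (set xs) f"
  shows "order_isomorphic xs (map f xs)"
  unfolding order_isomorphic_def using strict_mono_on_less[OF assms] by simp

text \<open>Equal entries of \<open>xs\<close> face equal entries of \<open>ys\<close>, since
  neither of the latter is smaller. So sending an entry to what stands at any of its positions is
  well defined and strictly increasing.\<close>

lemma order_isomorphicE:
  assumes "order_isomorphic xs ys"
  obtains f where "strict_mono_on (set xs) f" "ys = map f xs"
proof
  define f where "f x = ys ! (SOME i. i < length xs \<and> xs ! i = x)" for x
  have iff: "xs ! i < xs ! j \<longleftrightarrow> ys ! i < ys ! j" if "i < length xs" "j < length xs" for i j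
    using assms that unfolding order_isomorphic_def by blast
  have len: "length xs = length ys"
    using assms unfolding order_isomorphic_def by blast
  have f: "f (xs ! i) = ys ! i" if i: "i < length xs" for i
  proof -
    define j where "j = (SOME j. j < length xs \<and> xs ! j = xs ! i)"
    have j: "j < length xs \<and> xs ! j = xs ! i"
      unfolding j_def by (rule someI_ex) (use i in blast)
    then have "\<not> ys ! j < ys ! i" "\<not> ys ! i < ys ! j"
      using iff[of i j] iff[of j i] i by simp_all
    then show ?thesis unfolding f_def j_def[symmetric] by simp
  qed
  show "ys = map f xs"
    by (rule nth_equalityI) (use len f in simp_all)
  show "strict_mono_on (set xs) f"
  proof (rule strict_mono_onI)
    fix x y assume xy: "x \<in> set xs" "y \<in> set xs" "x < y"
    then obtain i j where "i < length xs" "x = xs ! i" "j < length xs" "y = xs ! j"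
      by (metis in_set_conv_nth)
    then show "f x < f y" using xy(3) iff f by simp
  qed
qed

lemma order_isomorphic_refl: "order_isomorphic xs xs"
  by (simp add: order_isomorphic_def)

lemma order_isomorphic_sym: "order_isomorphic xs ys \<Longrightarrow> order_isomorphic ys xs"
  by (auto simp: order_isomorphic_def)

lemma order_isomorphic_trans:
  "order_isomorphic xs ys \<Longrightarrow> order_isomorphic ys zs \<Longrightarrow> order_isomorphic xs zs"
  by (auto simp: order_isomorphic_def)

lemma order_isomorphic_rev: "order_isomorphic (rev xs) (rev ys) \<longleftrightarrow> order_isomorphic xs ys"
proof -
  have "order_isomorphic (rev xs) (rev ys)" if "order_isomorphic xs ys" for xs ys
    using that by (auto simp: order_isomorphic_def rev_nth)
  from this[of xs ys] this[of "rev xs" "rev ys"] show ?thesis by auto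
qed

lemma order_isomorphic_length: "order_isomorphic xs ys \<Longrightarrow> length xs = length ys"
  by (simp add: order_isomorphic_def)

lemma order_isomorphic_Cons:
  "order_isomorphic (x # xs) (y # ys) \<longleftrightarrow> order_isomorphic xs ys \<and>
     (\<forall>i<length xs. (x < xs ! i \<longleftrightarrow> y < ys ! i) \<and> (xs ! i < x \<longleftrightarrow> ys ! i < y))"
  by (simp add: order_isomorphic_def All_less_Suc2) blast

text \<open>A strictly increasing map onto \<open>{1..k}\<close> sends the entries up to
  \<open>x\<close> bijectively onto \<open>{1..f x}\<close>, so its value at \<open>x\<close> is the
  rank of \<open>x\<close>.\<close>

lemma order_isomorphic_perms_rank:
  assumes "order_isomorphic xs s" "s \<in> perms k"
  shows "s = map (\<lambda>x. card {y \<in> set xs. y \<le> x}) xs"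
proof -
  obtain f where f: "strict_mono_on (set xs) f" "s = map f xs"
    using assms(1) by (rule order_isomorphicE)
  have "card {y \<in> set xs. y \<le> x} = f x" if x: "x \<in> set xs" for x
  proof -
    have "f ` {y \<in> set xs. y \<le> x} = {z \<in> set s. z \<le> f x}"
      using f x by (auto simp: strict_mono_on_less_eq[OF f(1)])
    also have "\<dots> = {1..f x}"
    proof -
      have s: "set s = {1..k}"
        using assms(2) by (simp add: permutations_of_set_def)
      then have "f x \<le> k"
        using f(2) x by auto
      then show ?thesis using s by auto
    qed
    finally have "card (f ` {y \<in> set xs. y \<le> x}) = f x" by simp
    then show ?thesis
      using card_image[OF inj_on_subset[OF strict_mono_on_imp_inj_on[OF f(1)]],
          of "{y \<in> set xs. y \<le> x}"]
      by auto
  qed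
  then show ?thesis using f(2) by simp
qed

lemma order_isomorphic_perms_eq:
  assumes "order_isomorphic p q" "p \<in> perms k" "q \<in> perms k"
  shows "p = q"
  using order_isomorphic_perms_rank[OF assms(1,3)]
    order_isomorphic_perms_rank[OF order_isomorphic_refl assms(2)] by simp

lemma containsI: "subseq xs \<pi> \<Longrightarrow> order_isomorphic xs p \<Longrightarrow> contains \<pi> p"
  by (auto simp: contains_def)

text \<open>An occurrence of \<open>p\<close> in \<open>s\<close> is pulled back as a set of
  positions: an order isomorphism changes values but not positions.\<close>

lemma contains_trans:
  assumes "contains \<pi> s" "contains s p"
  shows "contains \<pi> p"
proof -
  obtain xs where xs: "subseq xs \<pi>" "order_isomorphic xs s"
    using assms(1) by (auto simp: contains_def)
  obtain ys where ys: "subseq ys s" "order_isomorphic ys p"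
    using assms(2) by (auto simp: contains_def)
  obtain f where f: "strict_mono_on (set xs) f" "s = map f xs"
    using xs(2) by (rule order_isomorphicE)
  obtain N where "ys = nths s N"
    using ys(1) subseq_conv_nths by blast
  then have N: "ys = map f (nths xs N)"
    by (simp add: f(2) nths_map)
  have "order_isomorphic (nths xs N) ys"
    unfolding N using f(1)
    by (intro order_isomorphic_map) (auto intro: monotone_on_subset dest: in_set_nthsD)
  moreover have "subseq (nths xs N) \<pi>"
    using xs(1) subseq_conv_nths subseq_order.trans by blast
  ultimately show ?thesis
    using ys(2) by (blast intro: containsI order_isomorphic_trans)
qed

lemma contains_order_isomorphic: "contains \<pi> p \<Longrightarrow> order_isomorphic p q \<Longrightarrow> contains \<pi> q"
  unfolding contains_def using order_isomorphic_trans by blast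

section \<open>Symmetry under reversal\<close>

lemma subseq_rev: "subseq (rev xs) (rev ys) \<longleftrightarrow> subseq xs ys"
proof -
  have "subseq (rev xs) (rev ys)" if "subseq xs ys" for xs ys :: "'a list"
    using that by (induction rule: list_emb.induct) (auto intro: list_emb_append_mono)
  from this[of xs ys] this[of "rev xs" "rev ys"] show ?thesis by auto
qed

lemma contains_rev: "contains (rev \<pi>) (rev p) \<longleftrightarrow> contains \<pi> p"
proof -
  have "contains (rev \<pi>) (rev p)" if "contains \<pi> p" for \<pi> p
    using that unfolding contains_def by (metis subseq_rev order_isomorphic_rev)
  from this[of \<pi> p] this[of "rev \<pi>" "rev p"] show ?thesis by auto
qed

lemma contains_rev_right: "contains \<pi> (rev p) \<longleftrightarrow> contains (rev \<pi>) p"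
  using contains_rev[of "rev \<pi>" p] by simp

lemma rev_perms_iff: "rev \<pi> \<in> perms n \<longleftrightarrow> \<pi> \<in> perms n"
  by (auto simp: permutations_of_set_def)

lemma perms_length: "p \<in> perms n \<Longrightarrow> length p = n"
  by (auto simp: permutations_of_set_def dest: distinct_card)

section \<open>Increasing and decreasing subsequences\<close>

lemma sorted_wrt_less_order_isomorphic:
  fixes xs ys :: "nat list"
  assumes "sorted_wrt (<) xs" "sorted_wrt (<) ys" "length xs = length ys"
  shows "order_isomorphic xs ys"
  using assms unfolding order_isomorphic_def
  by (metis linorder_neqE_nat not_less_iff_gr_or_eq sorted_wrt_nth_less)

text \<open>The left-to-right minima decrease, and every other entry has a smaller one to its left.\<close>

fun minima_below :: "'a::linorder \<Rightarrow> 'a list \<Rightarrow> 'a list" where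
  "minima_below m [] = []"
| "minima_below m (x # xs) = (if x < m then x # minima_below x xs else minima_below m xs)"

fun non_minima_below :: "'a::linorder \<Rightarrow> 'a list \<Rightarrow> 'a list" where
  "non_minima_below m [] = []"
| "non_minima_below m (x # xs) =
     (if x < m then non_minima_below x xs else x # non_minima_below m xs)"

lemma length_minima: "length (minima_below m xs) + length (non_minima_below m xs) = length xs"
  by (induction xs arbitrary: m) auto

lemma subseq_minima: "subseq (minima_below m xs) xs"
  by (induction xs arbitrary: m) auto

lemma subseq_non_minima: "subseq (non_minima_below m xs) xs"
  by (induction xs arbitrary: m) auto

lemma minima_sorted: "sorted_wrt (>) (m # minima_below m xs)"
  by (induction xs arbitrary: m) fastforce+

text \<open>The witness is the running minimum at the place where \<open>y\<close> is matched: it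
  stands before \<open>y\<close> and, as \<open>y\<close> did not become a new minimum and entries
  are distinct, below it.\<close>

lemma non_minima_extend:
  assumes "subseq (y # ys) (non_minima_below m xs)" "distinct (m # xs)"
  shows "\<exists>x. subseq (x # y # ys) (m # xs) \<and> x < y"
  using assms
proof (induction xs arbitrary: m)
  case (Cons x xs)
  show ?case
  proof (cases "x < m")
    case True
    then have "\<exists>z. subseq (z # y # ys) (x # xs) \<and> z < y"
      using Cons.IH[of x] Cons.prems by auto
    then show ?thesis by (meson list_emb_Cons)
  next
    case False
    then have "m < x" using Cons.prems by auto
    show ?thesis
    proof (cases "y = x")
      case True
      then have "subseq ys (non_minima_below m xs)"
        using False Cons.prems by simp
      then have "subseq (m # y # ys) (m # x # xs)"
        using True subseq_non_minima[of m xs] by (auto intro: subseq_order.trans)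
      then show ?thesis using \<open>m < x\<close> True by blast
    next
      case neq: False
      then have "subseq (y # ys) (non_minima_below m xs)"
        using False Cons.prems by simp
      then obtain z where z: "subseq (z # y # ys) (m # xs)" "z < y"
        using Cons.IH[of m] Cons.prems by auto
      have "subseq (m # xs) (m # x # xs)" by auto
      then show ?thesis using z subseq_order.trans by blast
    qed
  qed
qed simp

text \<open>More than \<open>k\<close> left-to-right minima form a long decreasing sequence.
  Otherwise deleting them removes at most \<open>k\<close> entries, and an increasing sequence among
  the rest gains a smaller entry on its left.\<close>

theorem erdos_szekeres:
  fixes xs :: "'a::linorder list"
  assumes "distinct xs" "length xs > r * k"
  shows "(\<exists>ys. subseq ys xs \<and> length ys = Suc r \<and> sorted_wrt (<) ys) \<or>
         (\<exists>ys. subseq ys xs \<and> length ys = Suc k \<and> sorted_wrt (>) ys)"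
  using assms
proof (induction r arbitrary: xs)
  case 0
  then obtain x xs' where "xs = x # xs'" by (cases xs) auto
  then have "subseq [x] xs" by simp
  moreover have "length [x] = Suc 0" "sorted_wrt (<) [x]" by simp_all
  ultimately show ?case by blast
next
  case (Suc r)
  then obtain m zs where xs: "xs = m # zs" by (cases xs) auto
  let ?M = "m # minima_below m zs" and ?R = "non_minima_below m zs"
  have M: "subseq ?M xs" "sorted_wrt (>) ?M"
    using subseq_minima[of m zs] minima_sorted[of m zs] xs by auto
  show ?case
  proof (cases "length ?M > k")
    case True
    have "subseq (take (Suc k) ?M) xs"
      using M(1) by (meson prefix_imp_subseq subseq_order.trans take_is_prefix)
    moreover have "length (take (Suc k) ?M) = Suc k" using True by simp
    moreover have "sorted_wrt (>) (take (Suc k) ?M)"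
      using M(2) by (rule sorted_wrt_take)
    ultimately show ?thesis by blast
  next
    case False
    then have "length ?R > r * k"
      using length_minima[of m zs] Suc.prems(2) xs by simp
    moreover have R: "subseq ?R xs"
      using subseq_non_minima[of m zs] xs by auto
    moreover have "distinct ?R"
      using R Suc.prems(1) by (metis subseq_conv_nths distinct_nthsI)
    ultimately consider ys where "subseq ys ?R" "length ys = Suc r" "sorted_wrt (<) ys"
      | ys where "subseq ys ?R" "length ys = Suc k" "sorted_wrt (>) ys"
      using Suc.IH by blast
    then show ?thesis
    proof cases
      case 1
      then obtain y ys' where y: "ys = y # ys'" by (cases ys) auto
      then obtain x where x: "subseq (x # ys) xs" "x < y"
        using non_minima_extend[of y ys' m zs] 1(1) Suc.prems(1) xs by auto
      then have "sorted_wrt (<) (x # ys)" using 1(3) y by auto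
      then show ?thesis using x(1) 1(2) by (metis length_Cons)
    next
      case 2
      then show ?thesis using R subseq_order.trans by blast
    qed
  qed
qed

lemma contains_monotone:
  assumes "\<pi> \<in> perms n" "n \<ge> 10"
  shows "contains \<pi> [1,2,3,4] \<or> contains \<pi> (rev [1,2,3,4])"
proof -
  have "distinct \<pi>" "length \<pi> > 3 * 3"
    using assms perms_length by (auto simp: permutations_of_set_def)
  then consider ys where "subseq ys \<pi>" "length ys = 4" "sorted_wrt (<) ys"
    | ys where "subseq ys \<pi>" "length ys = 4" "sorted_wrt (>) ys"
    using erdos_szekeres[of \<pi> 3 3] by auto
  then show ?thesis
  proof cases
    case 1
    then have "order_isomorphic ys [1,2,3,4]"
      by (intro sorted_wrt_less_order_isomorphic) auto
    then show ?thesis using 1 containsI by blast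
  next
    case 2
    then have "order_isomorphic (rev ys) [1,2,3,4]"
      by (intro sorted_wrt_less_order_isomorphic) (auto simp: sorted_wrt_rev)
    then have "order_isomorphic ys (rev [1,2,3,4])"
      using order_isomorphic_rev[of "rev ys" "[1,2,3,4]"] by simp
    then show ?thesis using 2 containsI by blast
  qed
qed

section \<open>Reply strategies\<close>

lemma mex_eq_0_iff: "finite A \<Longrightarrow> mex A = 0 \<longleftrightarrow> 0 \<notin> A"
proof
  assume "finite A" "mex A = 0"
  then obtain m where "m \<notin> A"
    using ex_new_if_finite infinite_UNIV_nat by blast
  then have "mex A \<notin> A" unfolding mex_def by (rule LeastI)
  then show "0 \<notin> A" using \<open>mex A = 0\<close> by simp
qed (simp add: mex_def)

lemma sg_eq_0_iff: "sg k X = 0 \<longleftrightarrow> (\<forall>p\<in>legal_moves k X. sg k (move X p) \<noteq> 0)"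
  by (subst sg.simps) (auto simp: mex_eq_0_iff finite_legal_moves)

text \<open>\<open>I\<close> describes the positions that are safe for the answering player. A legal
  reply leads back to \<open>I\<close> with fewer legal patterns, by induction to value 0, so every
  first move leads to a nonzero value.\<close>

lemma sg_eq_0_if_replies:
  assumes inv: "I X"
    and reply: "\<And>X p. I X \<Longrightarrow> p \<in> legal_moves k X \<Longrightarrow>
      f p \<in> legal_moves k (move X p) \<and> I (move (move X p) (f p))"
  shows "sg k X = 0"
  using inv
proof (induction "card (legal_moves k X)" arbitrary: X rule: less_induct)
  case less
  have "sg k (move X p) \<noteq> 0" if p: "p \<in> legal_moves k X" for p
  proof -
    have r: "f p \<in> legal_moves k (move X p)" "I (move (move X p) (f p))"
      using reply[OF less.prems p] by auto
    have "card (legal_moves k (move (move X p) (f p))) < card (legal_moves k X)"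
      using card_legal_moves_move_less[OF p] card_legal_moves_move_less[OF r(1)] by simp
    then have "sg k (move (move X p) (f p)) = 0" using less.hyps r(2) by blast
    then show ?thesis using sg_eq_0_iff r(1) by blast
  qed
  then show ?case using sg_eq_0_iff by blast
qed

text \<open>The earlier replies are legal by assumption on the play, so the rounds only transport
  \<open>I\<close> to the position where the last pattern is chosen.\<close>

lemma reverse_strategy_winning_if_replies:
  assumes inv: "I X"
    and reply: "\<And>X p. I X \<Longrightarrow> p \<in> legal_moves k X \<Longrightarrow>
      rev p \<in> legal_moves k (move X p) \<and> I (move (move X p) (rev p))"
  shows "reverse_strategy_winning k X"
proof -
  have "legal_play k X (with_reverse_replies ps @ [p]) \<longrightarrow>
      legal_play k X (with_reverse_replies ps @ [p, rev p])" for ps p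
    using inv
  proof (induction ps arbitrary: X)
    case Nil
    then show ?case using reply by (auto simp: with_reverse_replies_def)
  next
    case (Cons q ps)
    then show ?case using reply by (auto simp: with_reverse_replies_def)
  qed
  then show ?thesis by (simp add: reverse_strategy_winning_def)
qed

section \<open>Searching the one-point extensions of a pattern\<close>

fun subseqs_of_length :: "nat \<Rightarrow> 'a list \<Rightarrow> 'a list list" where
  "subseqs_of_length 0 xs = [[]]"
| "subseqs_of_length (Suc k) [] = []"
| "subseqs_of_length (Suc k) (x # xs) =
     map (Cons x) (subseqs_of_length k xs) @ subseqs_of_length (Suc k) xs"

fun subseqs_through :: "nat \<Rightarrow> 'a list \<Rightarrow> 'a \<Rightarrow> 'a list \<Rightarrow> 'a list list" where
  "subseqs_through 0 us v ws = []"
| "subseqs_through (Suc k) [] v ws = map (Cons v) (subseqs_of_length k ws)"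
| "subseqs_through (Suc k) (u # us) v ws =
     map (Cons u) (subseqs_through k us v ws) @ subseqs_through (Suc k) us v ws"

text \<open>The comparison matrix above the diagonal, an executable code for the order type.\<close>

fun comparisons :: "nat list \<Rightarrow> bool list" where
  "comparisons [] = []"
| "comparisons (x # xs) = map ((<) x) xs @ comparisons xs"

text \<open>For distinct entries this determines \<open>q\<close> up to order isomorphism and reversal.\<close>

definition reversal_type :: "nat list \<Rightarrow> bool list" where
  "reversal_type q = comparisons (if hd q < last q then q else rev q)"

definition raise :: "nat \<Rightarrow> nat \<Rightarrow> nat" where
  "raise v x = (if x < v then x else Suc x)"

fun splits :: "'a list \<Rightarrow> ('a list \<times> 'a list) list" where
  "splits [] = [([], [])]"
| "splits (x # xs) = ([], x # xs) # map (apfst (Cons x)) (splits xs)"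

definition insertions :: "nat list \<Rightarrow> nat \<Rightarrow> (nat list \<times> nat \<times> nat list) list" where
  "insertions s v = map (apsnd (Pair v)) (splits (map (raise v) s))"

fun insert_mid :: "'a list \<times> 'a \<times> 'a list \<Rightarrow> 'a list" where
  "insert_mid (us, v, ws) = us @ v # ws"

definition has_all :: "'a list \<Rightarrow> 'a list \<Rightarrow> bool" where
  "has_all qs F \<longleftrightarrow> list_all (List.member qs) F"

text \<open>Only subsequences through the inserted entry are listed, because the others occur already in the
  list that is being extended.\<close>

fun uncovered :: "bool list list list \<Rightarrow> nat list \<times> nat \<times> nat list \<Rightarrow> bool" where
  "uncovered Fs (us, v, ws) \<longleftrightarrow>
     \<not> list_ex (has_all (map reversal_type (subseqs_through 4 us v ws))) Fs"

text \<open>Every \<open>F\<close> in \<open>Fs\<close> is a set of patterns up to reversal; an extension is discarded as soon as all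
  patterns of some \<open>F\<close> occur.\<close>

definition uncovered_extensions :: "bool list list list \<Rightarrow> nat list \<Rightarrow> nat list list" where
  "uncovered_extensions Fs s = map insert_mid
     (filter (uncovered (map (filter (Not \<circ> List.member (map reversal_type (subseqs_of_length 4 s)))) Fs))
       (concat (map (insertions s) [1..<length s + 2])))"

definition uncovered_step :: "bool list list list \<Rightarrow> nat list list \<Rightarrow> nat list list" where
  "uncovered_step Fs S = remdups (concat (map (uncovered_extensions Fs) S))"

section \<open>Codes for patterns up to reversal\<close>

lemma subseq_distinct: "subseq xs ys \<Longrightarrow> distinct ys \<Longrightarrow> distinct xs"
  by (metis subseq_conv_nths distinct_nthsI)

lemma set_subseqs_of_length: "set (subseqs_of_length k xs) = {ys. subseq ys xs \<and> length ys = k}"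
proof (induction k xs rule: subseqs_of_length.induct)
  case (3 k x xs)
  have "subseq ys (x # xs) \<and> length ys = Suc k \<longleftrightarrow>
      (\<exists>zs. ys = x # zs \<and> subseq zs xs \<and> length zs = k) \<or> subseq ys xs \<and> length ys = Suc k" for ys
  proof (cases ys)
    case (Cons y zs)
    then show ?thesis
      by (cases "y = x") (auto dest: subseq_Cons' subseq_Cons2_neq)
  qed simp
  then show ?case using 3 by auto
qed auto

lemma set_subseqs_through: "set (subseqs_through k us v ws) \<subseteq> set (subseqs_of_length k (us @ v # ws))"
proof (induction k us v ws rule: subseqs_through.induct)
  case (3 k u us v ws)
  then show ?case by auto
qed auto

text \<open>For distinct entries \<open>x > y\<close> is the negation of \<open>x < y\<close>, so
  comparing each entry with the later ones suffices.\<close>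

lemma order_isomorphic_iff_comparisons:
  assumes "length xs = length ys" "distinct xs" "distinct ys"
  shows "order_isomorphic xs ys \<longleftrightarrow> comparisons xs = comparisons ys"
  using assms
proof (induction xs ys rule: list_induct2)
  case Nil
  then show ?case by (simp add: order_isomorphic_def)
next
  case (Cons x xs y ys)
  have "(\<forall>i<length xs. (x < xs ! i \<longleftrightarrow> y < ys ! i) \<and> (xs ! i < x \<longleftrightarrow> ys ! i < y)) \<longleftrightarrow>
      (\<forall>i<length xs. x < xs ! i \<longleftrightarrow> y < ys ! i)" (is "?l \<longleftrightarrow> ?r")
  proof
    assume ?r
    moreover have "x \<noteq> xs ! i" "y \<noteq> ys ! i" if "i < length xs" for i
      using Cons.hyps Cons.prems that by auto
    ultimately show ?l by (meson less_asym linorder_neqE_nat)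
  qed blast
  also have "\<dots> \<longleftrightarrow> map ((<) x) xs = map ((<) y) ys"
    using Cons.hyps by (auto simp: list_eq_iff_nth_eq)
  finally show ?case
    using Cons by (auto simp: order_isomorphic_Cons)
qed

lemma contains_iff_comparisons:
  assumes "distinct \<pi>" "distinct p"
  shows "contains \<pi> p \<longleftrightarrow> comparisons p \<in> comparisons ` set (subseqs_of_length (length p) \<pi>)"
proof -
  have "order_isomorphic xs p \<longleftrightarrow> length xs = length p \<and> comparisons xs = comparisons p"
    if "subseq xs \<pi>" for xs
    using order_isomorphic_iff_comparisons[of xs p] subseq_distinct[OF that assms(1)] assms(2)
    by (auto dest: order_isomorphic_length)
  then show ?thesis
    unfolding contains_def set_subseqs_of_length by (auto simp: image_iff)
qed

text \<open>Each list is coded after a possible reversal. Among the four combinations, equal choices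
  give \<open>ys\<close> and unequal ones \<open>rev ys\<close>.\<close>

lemma reversal_type_eqD:
  assumes "reversal_type xs = reversal_type ys" "length xs = length ys" "distinct xs" "distinct ys"
  shows "order_isomorphic xs ys \<or> order_isomorphic xs (rev ys)"
  using assms order_isomorphic_iff_comparisons[of xs ys] order_isomorphic_iff_comparisons[of "rev xs" ys]
    order_isomorphic_iff_comparisons[of xs "rev ys"] order_isomorphic_iff_comparisons[of "rev xs" "rev ys"]
    order_isomorphic_rev[of xs ys] order_isomorphic_rev[of xs "rev ys"]
  by (auto simp: reversal_type_def split: if_splits)

text \<open>Arbitrary distinct lists are allowed as patterns, so that subsequences can be used
  without being standardised to permutations.\<close>

definition reversal_types :: "nat list \<Rightarrow> bool list set" where
  "reversal_types \<pi> = {reversal_type ys |ys. contains \<pi> ys \<and> length ys = 4 \<and> distinct ys}"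

lemma reversal_types_mono: "contains \<pi> s \<Longrightarrow> reversal_types s \<subseteq> reversal_types \<pi>"
  unfolding reversal_types_def using contains_trans by blast

lemma reversal_type_in_types:
  "distinct s \<Longrightarrow> ys \<in> set (subseqs_of_length 4 s) \<Longrightarrow> reversal_type ys \<in> reversal_types s"
proof -
  assume "distinct s" "ys \<in> set (subseqs_of_length 4 s)"
  then have ys: "subseq ys s" "length ys = 4"
    by (simp_all add: set_subseqs_of_length)
  have "contains s ys"
    using ys(1) order_isomorphic_refl by (rule containsI)
  moreover have "distinct ys"
    using ys(1) \<open>distinct s\<close> by (rule subseq_distinct)
  ultimately show ?thesis
    unfolding reversal_types_def using ys(2) by blast
qed

lemma reversal_types_containsD:
  assumes "reversal_type q \<in> reversal_types \<pi>" "length q = 4" "distinct q"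
  shows "contains \<pi> q \<or> contains \<pi> (rev q)"
proof -
  obtain ys where "contains \<pi> ys" "length ys = 4" "distinct ys" "reversal_type ys = reversal_type q"
    using assms(1) unfolding reversal_types_def by auto
  then show ?thesis
    using reversal_type_eqD[of ys q] assms(2,3) contains_order_isomorphic by metis
qed

section \<open>Soundness of growing an occurrence by one entry\<close>

lemma set_splits: "set (splits xs) = {(us, ws). us @ ws = xs}"
  by (induction xs) (auto simp: Cons_eq_append_conv append_eq_Cons_conv image_iff)

lemma insertions_iff:
  "x \<in> set (insertions s v) \<longleftrightarrow> (\<exists>us ws. x = (us, v, ws) \<and> us @ ws = map (raise v) s)"
  by (auto simp: insertions_def set_splits image_iff)

lemma insertions_perms:
  assumes "x \<in> set (insertions s v)" "s \<in> perms k" "v \<in> {1..Suc k}"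
  shows "insert_mid x \<in> perms (Suc k)"
proof -
  obtain us ws where x: "x = (us, v, ws)" "us @ ws = map (raise v) s"
    using assms(1) insertions_iff by blast
  have s: "set s = {1..k}" "distinct s"
    using assms(2) by (auto simp: permutations_of_set_def)
  have "inj (raise v)"
    by (auto simp: inj_def raise_def split: if_splits)
  then have "distinct (us @ ws)"
    unfolding x(2) using s(2) by (simp add: distinct_map inj_on_def)
  moreover have "raise v ` {1..k} = {1..Suc k} - {v}"
  proof (intro equalityI subsetI)
    fix y assume y: "y \<in> {1..Suc k} - {v}"
    then have "y = raise v (if y < v then y else y - 1)" "(if y < v then y else y - 1) \<in> {1..k}"
      using assms(3) by (auto simp: raise_def)
    then show "y \<in> raise v ` {1..k}" by blast
  qed (auto simp: raise_def)
  then have "set (us @ ws) = {1..Suc k} - {v}"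
    unfolding x(2) using s(1) by simp
  ultimately show ?thesis
    using assms(3) unfolding x(1) permutations_of_set_def by auto
qed

text \<open>The embedding is followed from the left. A skipped entry is put in front if the
  remaining list is matched completely; otherwise the induction finds one further right.\<close>

lemma subseq_one_more:
  assumes "subseq xs ys" "length xs < length ys"
  obtains us a ws where "xs = us @ ws" "subseq (us @ a # ws) ys"
  using assms
proof (induction arbitrary: thesis rule: list_emb.induct)
  case (list_emb_Nil ys)
  then obtain a ys' where "ys = a # ys'" by (cases ys) auto
  then show ?case using list_emb_Nil(1)[of "[]" "[]" a] by simp
next
  case (list_emb_Cons xs ys y)
  show ?case
  proof (cases "length xs < length ys")
    case True
    obtain us a ws where "xs = us @ ws" "subseq (us @ a # ws) ys"
      using list_emb_Cons.IH[OF _ True] .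
    show ?thesis
    proof (rule list_emb_Cons.prems(1))
      show "xs = us @ ws" by fact
      show "subseq (us @ a # ws) (y # ys)"
        using \<open>subseq (us @ a # ws) ys\<close> by (rule list_emb.list_emb_Cons)
    qed
  next
    case False
    then have "length xs = length ys"
      using list_emb_length[OF list_emb_Cons(1)] by simp
    with list_emb_Cons(1) have "xs = ys"
      by (rule subseq_same_length)
    then show ?thesis
      using list_emb_Cons.prems(1)[of "[]" xs y] by simp
  qed
next
  case (list_emb_Cons2 x y xs ys)
  then have "length xs < length ys" by simp
  then obtain us a ws where "xs = us @ ws" "subseq (us @ a # ws) ys"
    using list_emb_Cons2.IH by metis
  then show ?case
    using list_emb_Cons2.prems(1)[of "x # us" ws a] list_emb_Cons2.hyps(1) by simp
qed

text \<open>Since \<open>\<pi>\<close> is longer, the occurrence can be enlarged by an entry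
  \<open>a\<close>. Standardising the enlarged occurrence gives an insertion into
  \<open>s\<close>.\<close>

lemma contains_insertion:
  assumes "distinct \<pi>" "contains \<pi> s" "s \<in> perms k" "k < length \<pi>"
  shows "\<exists>v\<in>{1..Suc k}. \<exists>x\<in>set (insertions s v). contains \<pi> (insert_mid x)"
proof -
  obtain xs where xs: "subseq xs \<pi>" "order_isomorphic xs s"
    using assms(2) by (auto simp: contains_def)
  have k: "length xs = k"
    using xs(2) assms(3) order_isomorphic_length perms_length by simp
  then obtain us a ws where uw: "xs = us @ ws" "subseq (us @ a # ws) \<pi>"
    using subseq_one_more[OF xs(1)] assms(4) by metis
  have "distinct (us @ a # ws)"
    using uw(2) assms(1) by (rule subseq_distinct)
  then have a: "a \<notin> set xs" using uw(1) by simp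
  define rk where "rk x = card {y \<in> set xs. y \<le> x}" for x
  \<comment> \<open>The rank that \<open>a\<close> receives: one more than the number of entries of
    the occurrence below it.\<close>
  define v where "v = Suc (rk a)"
  have s: "s = map rk xs"
    using order_isomorphic_perms_rank[OF xs(2) assms(3)] by (simp add: rk_def)
  have mono: "rk x \<le> rk y" if "x \<le> y" for x y
    unfolding rk_def using that by (intro card_mono) auto
  have strict: "rk x < rk y" if "x < y" "y \<in> set xs" for x y
  proof -
    have y: "y \<in> {z \<in> set xs. z \<le> y}" "y \<notin> {z \<in> set xs. z \<le> x}"
      using that by auto
    have "{z \<in> set xs. z \<le> x} \<subseteq> {z \<in> set xs. z \<le> y}"
      using that(1) by auto
    with y have "{z \<in> set xs. z \<le> x} \<subset> {z \<in> set xs. z \<le> y}"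
      by blast
    then show ?thesis unfolding rk_def by (intro psubset_card_mono) auto
  qed
  define g where "g x = (if x = a then v else raise v (rk x))" for x
  have "strict_mono_on (set (us @ a # ws)) g"
  proof (rule strict_mono_onI)
    fix x y assume xy: "x \<in> set (us @ a # ws)" "y \<in> set (us @ a # ws)" "x < y"
    then have "x = a \<or> x \<in> set xs" "y = a \<or> y \<in> set xs"
      using uw(1) by auto
    then consider "x = a" "y \<in> set xs" | "x \<in> set xs" "y = a" | "x \<in> set xs" "y \<in> set xs"
      using xy(3) by auto
    then show "g x < g y"
    proof cases
      case 1
      then show ?thesis using a xy(3) strict[of a y] by (auto simp: g_def v_def raise_def)
    next
      case 2
      then show ?thesis using a xy(3) mono[of x a] by (auto simp: g_def v_def raise_def)
    next
      case 3
      then show ?thesis using a xy(3) strict[of x y] by (auto simp: g_def raise_def)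
    qed
  qed
  then have iso: "order_isomorphic (us @ a # ws) (map g (us @ a # ws))"
    by (rule order_isomorphic_map)
  have g: "map g us = map (raise v \<circ> rk) us" "map g ws = map (raise v \<circ> rk) ws"
    using a uw(1) by (auto simp: g_def)
  have "g a = v" by (simp add: g_def)
  with iso have "order_isomorphic (us @ a # ws) (insert_mid (map g us, v, map g ws))"
    by simp
  then have "contains \<pi> (insert_mid (map g us, v, map g ws))"
    using uw(2) by (rule containsI[rotated])
  moreover have "(map g us, v, map g ws) \<in> set (insertions s v)"
    unfolding insertions_iff g s uw(1) by auto
  moreover have "v \<in> {1..Suc k}"
    using k card_length[of xs] card_mono[of "set xs" "{y \<in> set xs. y \<le> a}"]
    by (auto simp: v_def rk_def)
  ultimately show ?thesis by blast
qed

lemma uncovered_step_perms: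
  assumes "set S \<subseteq> perms k"
  shows "set (uncovered_step Fs S) \<subseteq> perms (Suc k)"
proof
  fix t assume "t \<in> set (uncovered_step Fs S)"
  then obtain s where s: "s \<in> set S" "t \<in> set (uncovered_extensions Fs s)"
    unfolding uncovered_step_def by auto
  then obtain x where x: "t = insert_mid x" "x \<in> set (concat (map (insertions s) [1..<length s + 2]))"
    unfolding uncovered_extensions_def set_map set_filter by blast
  then obtain v where v: "v \<in> set [1..<length s + 2]" "x \<in> set (insertions s v)"
    unfolding set_concat set_map by blast
  have "s \<in> perms k" using assms s(1) by blast
  moreover from this v(1) have "v \<in> {1..Suc k}"
    using perms_length[of s k] by auto
  ultimately show "t \<in> perms (Suc k)"
    unfolding x(1) using insertions_perms[OF v(2)] by blast
qed

text \<open>Growing the occurrence of \<open>s\<close> by one entry of \<open>\<pi>\<close> gives an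
  extension that either survives or is discarded. In the latter case each pattern of some
  \<open>F\<close> occurs in \<open>s\<close> or through the new entry, hence in
  \<open>\<pi>\<close>.\<close>

lemma uncovered_step_sound:
  assumes "distinct \<pi>" "set S \<subseteq> perms k" "k < length \<pi>" "s \<in> set S" "contains \<pi> s"
  shows "(\<exists>F\<in>set Fs. set F \<subseteq> reversal_types \<pi>) \<or> (\<exists>t\<in>set (uncovered_step Fs S). contains \<pi> t)"
proof -
  have s: "s \<in> perms k" using assms by blast
  obtain v x where x: "v \<in> {1..Suc k}" "x \<in> set (insertions s v)" "contains \<pi> (insert_mid x)"
    using contains_insertion[OF assms(1,5) s assms(3)] by blast
  obtain us ws where uw: "x = (us, v, ws)"
    using x(2) insertions_iff by blast
  \<comment> \<open>The patterns of each \<open>F\<close> not yet present in \<open>s\<close>; only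
    these are looked for through the new entry.\<close>
  let ?Fs = "map (filter (Not \<circ> List.member (map reversal_type (subseqs_of_length 4 s)))) Fs"
  show ?thesis
  proof (cases "uncovered ?Fs x")
    case True
    moreover have "v \<in> set [1..<length s + 2]"
      using x(1) perms_length[OF s] by auto
    then have "x \<in> set (concat (map (insertions s) [1..<length s + 2]))"
      using x(2) unfolding set_concat set_map by blast
    ultimately have "x \<in> set (filter (uncovered ?Fs) (concat (map (insertions s) [1..<length s + 2])))"
      by (simp only: set_filter mem_Collect_eq simp_thms)
    then have "insert_mid x \<in> set (uncovered_extensions Fs s)"
      unfolding uncovered_extensions_def set_map by (rule imageI)
    then have "insert_mid x \<in> set (uncovered_step Fs S)"
      using assms(4) by (auto simp: uncovered_step_def)
    then show ?thesis using x(3) by blast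
  next
    case False
    then obtain F where F: "F \<in> set Fs"
        "\<And>q. q \<in> set F \<Longrightarrow> q \<in> reversal_type ` set (subseqs_of_length 4 s) \<or>
          q \<in> reversal_type ` set (subseqs_through 4 us v ws)"
      unfolding uw by (auto simp: list_ex_iff list_all_iff has_all_def)
    have "distinct (insert_mid x)" "distinct s"
      using insertions_perms[OF x(2) s x(1)] s by (auto simp: permutations_of_set_def)
    have "reversal_type ` set (subseqs_through 4 us v ws) \<subseteq> reversal_types (insert_mid x)"
    proof (rule image_subsetI)
      fix ys assume "ys \<in> set (subseqs_through 4 us v ws)"
      then have "ys \<in> set (subseqs_of_length 4 (insert_mid x))"
        using set_subseqs_through[of 4 us v ws] unfolding uw insert_mid.simps by (rule subsetD[rotated])
      with \<open>distinct (insert_mid x)\<close> show "reversal_type ys \<in> reversal_types (insert_mid x)"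
        by (rule reversal_type_in_types)
    qed
    moreover have "reversal_type ` set (subseqs_of_length 4 s) \<subseteq> reversal_types s"
    proof (rule image_subsetI)
      fix ys assume "ys \<in> set (subseqs_of_length 4 s)"
      with \<open>distinct s\<close> show "reversal_type ys \<in> reversal_types s"
        by (rule reversal_type_in_types)
    qed
    ultimately have "q \<in> reversal_types \<pi>" if "q \<in> set F" for q
      using F(2)[OF that] reversal_types_mono[OF x(3)] reversal_types_mono[OF assms(5)] by (meson subsetD)
    then have "set F \<subseteq> reversal_types \<pi>" by (rule subsetI)
    then show ?thesis using F(1) by blast
  qed
qed

text \<open>While nothing is covered, the occurrence grows along the surviving lists; after
  \<open>j\<close> rounds it would belong to the empty list. The bound on \<open>k + j\<close>
  leaves an entry of \<open>\<pi>\<close> for each round.\<close>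

lemma covered_if_no_survivors:
  assumes "distinct \<pi>" "set S \<subseteq> perms k" "k + j \<le> length \<pi>" "s \<in> set S" "contains \<pi> s"
    and "(uncovered_step Fs ^^ j) S = []"
  shows "\<exists>F\<in>set Fs. set F \<subseteq> reversal_types \<pi>"
  using assms(2-)
proof (induction j arbitrary: S k s)
  case (Suc j)
  show ?case
  proof (rule ccontr)
    assume "\<not> ?case"
    then obtain t where "t \<in> set (uncovered_step Fs S)" "contains \<pi> t"
      using uncovered_step_sound[OF assms(1), of S k s Fs] Suc.prems by auto
    then have ?case
      using Suc.IH[of "uncovered_step Fs S" "Suc k" t] uncovered_step_perms[of S k] Suc.prems
      by (simp add: funpow_swap1)
    then show False using \<open>\<not> ?case\<close> by blast
  qed
qed simp

section \<open>Inflating a point to an increasing run\<close>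

text \<open>Entries above \<open>v\<close> move up by \<open>l - 1\<close> to make room for the run;
  \<open>l = 1\<close> returns \<open>s\<close>.\<close>

definition inflate :: "nat list \<Rightarrow> nat \<Rightarrow> nat \<Rightarrow> nat list" where
  "inflate s v l =
     concat (map (\<lambda>x. if x < v then [x] else if x = v then [v..<v + l] else [x + l - 1]) s)"

definition stretch :: "nat \<Rightarrow> nat \<Rightarrow> nat \<Rightarrow> nat" where
  "stretch v l x = (if x < v then x else x + l - 1)"

lemma inflate_split:
  assumes "v \<notin> set A \<union> set B"
  shows "inflate (A @ v # B) v l = map (stretch v l) A @ [v..<v + l] @ map (stretch v l) B"
proof -
  have "concat (map (\<lambda>x. if x < v then [x] else if x = v then [v..<v + l] else [x + l - 1]) C) =
      map (stretch v l) C" if "v \<notin> set C" for C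
    using that by (induction C) (auto simp: stretch_def)
  then show ?thesis using assms by (simp add: inflate_def)
qed

lemma inflate_perms:
  assumes "s \<in> perms k" "v \<in> set s" "l \<ge> 1"
  shows "inflate s v l \<in> perms (k + l - 1)"
proof -
  obtain A B where s: "s = A @ v # B"
    using assms(2) by (auto simp: in_set_conv_decomp)
  have AB: "distinct (A @ v # B)" "set A \<union> set B = {1..k} - {v}" "v \<in> {1..k}"
    using assms(1,2) unfolding s permutations_of_set_def by auto
  have "inj_on (stretch v l) {x. x \<noteq> v}"
    using assms(3) by (auto simp: inj_on_def stretch_def split: if_splits)
  then have inj: "inj_on (stretch v l) (set A \<union> set B)"
    by (rule inj_on_subset) (use AB in auto)
  have range: "stretch v l ` ({1..k} - {v}) = {1..k + l - 1} - {v..<v + l}"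
  proof (intro equalityI subsetI)
    fix y assume y: "y \<in> {1..k + l - 1} - {v..<v + l}"
    let ?x = "if y < v then y else y + 1 - l"
    have "y = stretch v l ?x" "?x \<in> {1..k} - {v}"
      using y AB(3) assms(3) by (auto simp: stretch_def)
    then show "y \<in> stretch v l ` ({1..k} - {v})" by blast
  qed (use assms(3) in \<open>auto simp: stretch_def\<close>)
  have "distinct (map (stretch v l) A @ map (stretch v l) B)"
    using AB(1) inj by (simp add: distinct_map flip: map_append)
  moreover have "set (map (stretch v l) A @ map (stretch v l) B) = {1..k + l - 1} - {v..<v + l}"
    using range AB(2) by (simp flip: image_Un)
  moreover have "{v..<v + l} \<subseteq> {1..k + l - 1}"
    using AB(3) by auto
  moreover have "inflate s v l = map (stretch v l) A @ [v..<v + l] @ map (stretch v l) B"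
    unfolding s using AB(1) by (intro inflate_split) auto
  ultimately show ?thesis
    unfolding permutations_of_set_def by auto
qed

text \<open>The part of \<open>ys\<close> inside the run is increasing and has at most
  \<open>m\<close> entries, so the first entries of a run of length \<open>m\<close> can replace it.
  The entries on both sides keep their relative order.\<close>

lemma inflate_contains_short:
  assumes "distinct s" "v \<in> set s" "subseq ys (inflate s v l)" "length ys \<le> m" "l \<ge> 1" "m \<ge> 1"
  shows "contains (inflate s v m) ys"
proof -
  obtain A B where s: "s = A @ v # B"
    using assms(2) by (auto simp: in_set_conv_decomp)
  have v: "v \<notin> set A \<union> set B"
    using assms(1) unfolding s by auto
  have "subseq ys (map (stretch v l) A @ [v..<v + l] @ map (stretch v l) B)"
    using assms(3) unfolding s inflate_split[OF v] .
  then obtain y1 y2 y3 where y: "ys = y1 @ y2 @ y3" "subseq y1 (map (stretch v l) A)"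
      "subseq y2 [v..<v + l]" "subseq y3 (map (stretch v l) B)"
    by (auto elim!: subseq_appendE)
  obtain a where a: "y1 = map (stretch v l) a" "subseq a A"
    using y(2) by (metis subseq_conv_nths nths_map)
  obtain b where b: "y3 = map (stretch v l) b" "subseq b B"
    using y(4) by (metis subseq_conv_nths nths_map)
  have ab: "v \<notin> set a" "v \<notin> set b"
    using v a(2) b(2) by (auto dest: list_emb_set)
  obtain N where N: "y2 = nths [v..<v + l] N"
    using y(3) subseq_conv_nths by blast
  have y2: "sorted_wrt (<) y2"
    unfolding N strict_sorted_iff by (simp add: sorted_nths distinct_nthsI)
  have "set y2 \<subseteq> {v..<v + l}"
    unfolding N using set_nths_subset[of "[v..<v + l]" N] by simp
  then have y2_range: "y2 ! j \<in> {v..<v + l}" if "j < length y2" for j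
    using that nth_mem by blast
  define zs where "zs = map (stretch v m) a @ [v..<v + length y2] @ map (stretch v m) b"
  have len: "length y2 \<le> m"
    using y(1) assms(4) by simp
  have "subseq zs (inflate s v m)"
  proof -
    have "subseq (map (stretch v m) a) (map (stretch v m) A)"
        "subseq (map (stretch v m) b) (map (stretch v m) B)"
      using a(2) b(2) by (auto intro: subseq_map)
    moreover have "subseq [v..<v + length y2] [v..<v + m]"
      using len upt_add_eq_append[of v "v + length y2" "m - length y2"]
        subseq_rev_drop_many[OF subseq_order.refl] by simp
    ultimately show ?thesis
      unfolding s inflate_split[OF v] zs_def by (intro list_emb_append_mono)
  qed
  moreover have "order_isomorphic zs ys"
  proof -
    \<comment> \<open>Maps the run to the chosen entries \<open>y2\<close> and replaces the shift
      for \<open>m\<close> by the one for \<open>l\<close> above it; values below \<open>v\<close>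
      stay.\<close>
    define f where "f x = (if x < v then x else if x < v + m then y2 ! (x - v) else x + l - m)" for x
    have fs: "f (stretch v m x) = stretch v l x" if "x \<noteq> v" for x
      using that assms(5,6) by (auto simp: f_def stretch_def)
    have "map f [v..<v + length y2] = y2"
      using len by (auto intro!: nth_equalityI simp: f_def)
    then have "map f zs = ys"
      unfolding zs_def y(1) a(1) b(1) using fs ab by (auto intro!: fs)
    moreover have "strict_mono_on (set zs) f"
    proof (rule strict_mono_onI)
      fix x y assume xy: "x \<in> set zs" "y \<in> set zs" "x < y"
      have st: "stretch v m z < v \<or> stretch v m z \<ge> v + m" if "z \<noteq> v" for z
        using that assms(6) by (auto simp: stretch_def)
      have range: "z < v \<or> z \<in> {v..<v + length y2} \<or> z \<ge> v + m" if "z \<in> set zs" for z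
      proof -
        have "z \<in> stretch v m ` set a \<union> {v..<v + length y2} \<union> stretch v m ` set b"
          using that by (simp add: zs_def)
        moreover have "x \<noteq> v" if "x \<in> set a \<union> set b" for x
          using that ab by auto
        ultimately show ?thesis using st by (metis UnE UnI1 UnI2 imageE)
      qed
      have f_mid: "f z = y2 ! (z - v)" "f z \<in> {v..<v + l}" if "z \<in> {v..<v + length y2}" for z
        using that len y2_range[of "z - v"] by (auto simp: f_def)
      \<comment> \<open>Values lie below, inside or above the run; with \<open>x < y\<close> six
        combinations of these zones remain.\<close>
      have "y < v \<Longrightarrow> x < v"
          "y \<in> {v..<v + length y2} \<Longrightarrow> x < v \<or> x \<in> {v..<v + length y2}"
          "x \<ge> v + m \<Longrightarrow> y \<ge> v + m"
        using xy(3) len by auto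
      then consider "x < v" "y < v" | "x < v" "y \<in> {v..<v + length y2}" | "x < v" "y \<ge> v + m"
        | "x \<in> {v..<v + length y2}" "y \<in> {v..<v + length y2}"
        | "x \<in> {v..<v + length y2}" "y \<ge> v + m" | "x \<ge> v + m" "y \<ge> v + m"
        using range[OF xy(1)] range[OF xy(2)] by blast
      then show "f x < f y"
      proof cases
        case 4
        then have "y2 ! (x - v) < y2 ! (y - v)"
          using xy(3) by (intro sorted_wrt_nth_less[OF y2]) auto
        then show ?thesis using 4 f_mid(1) by simp
      qed (use xy(3) f_mid(2)[of x] f_mid(2)[of y] assms(5,6) in \<open>auto simp: f_def\<close>)
    qed
    ultimately show ?thesis
      using order_isomorphic_map by metis
  qed
  ultimately show ?thesis by (rule containsI)
qed

text \<open>An occurrence has 4 entries, so it can be moved in both directions between runs of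
  length \<open>l\<close> and 4.\<close>

lemma inflate_contains_iff:
  assumes "distinct s" "v \<in> set s" "length q = 4" "l \<ge> 4"
  shows "contains (inflate s v l) q \<longleftrightarrow> contains (inflate s v 4) q"
proof -
  have "contains (inflate s v m) q" if "contains (inflate s v m') q" "m \<ge> 4" "m' \<ge> 4" for m m'
  proof -
    obtain ys where ys: "subseq ys (inflate s v m')" "order_isomorphic ys q"
      using \<open>contains (inflate s v m') q\<close> by (auto simp: contains_def)
    then have "contains (inflate s v m) ys"
      using inflate_contains_short[OF assms(1,2) ys(1), of m] assms(3) that(2,3)
        order_isomorphic_length[OF ys(2)] by simp
    then show ?thesis using ys(2) by (rule contains_order_isomorphic)
  qed
  then show ?thesis using assms(4) by blast
qed

section \<open>Certificates for the patterns of length 4\<close>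

text \<open>The increasing pattern is left out since \<open>contains_monotone\<close> provides it for free.\<close>

fun inflation_types :: "nat list \<times> nat \<Rightarrow> bool list list" where
  "inflation_types (s, v) = remdups (filter (Not \<circ> (=) (reversal_type [1,2,3,4]))
     (map reversal_type (subseqs_of_length 4 (inflate s v 4))))"

text \<open>The bound 7 leaves a run of at least 4 entries when the total length is at least 10.\<close>

fun separates :: "nat list \<Rightarrow> nat list \<times> nat \<Rightarrow> bool" where
  "separates c (s, v) \<longleftrightarrow> sort s = [1..<Suc (length s)] \<and> v \<in> set s \<and> length s \<le> 7 \<and>
     List.member (map comparisons (subseqs_of_length 4 (inflate s v 4))) (comparisons c) \<noteq>
     List.member (map comparisons (subseqs_of_length 4 (inflate s v 4))) (comparisons (rev c))"

text \<open>Each pair in \<open>ws\<close> has two roles: its patterns discard extensions of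
  \<open>c\<close>, and its inflation tells \<open>c\<close> from \<open>rev c\<close>. Three rounds
  reach lists with 7 entries.\<close>

definition certificate :: "nat list \<Rightarrow> (nat list \<times> nat) list \<Rightarrow> bool" where
  "certificate c ws \<longleftrightarrow>
     (uncovered_step (map inflation_types ws) ^^ 3) [c] = [] \<and> list_all (separates c) ws"

text \<open>The pairs \<open>(s, v)\<close>, standing for \<open>s\<close> with its entry \<open>v\<close> inflated, were found by a search over all
  \<open>s\<close> with at most 6 entries.\<close>

lemma certificate_1234: "certificate [1,2,3,4]
    [([1], 1)]"
  \<comment> \<open>The only pattern of the run is the increasing one, so the set to be covered is
    empty and the first round discards every extension.\<close>
  by code_simp

lemma certificate_1243: "certificate [1,2,4,3]
    [([1,3,2], 1)]"
  by code_simp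

lemma certificate_1324: "certificate [1,3,2,4]
    [([1,3,2,4], 1), ([1,3,2,4], 4), ([3,2,1], 2), ([1,3,2,4], 3), ([1,3,2,4], 2)]"
  by code_simp

lemma certificate_1342: "certificate [1,3,4,2]
    [([1,3,2], 3), ([1,3,4,2], 1), ([1,3,4,2], 2), ([2,4,3,1], 1), ([1,3,4,2,5], 5),
     ([2,5,3,1,4], 4)]"
  by code_simp

lemma certificate_1423: "certificate [1,4,2,3]
    [([1,3,2], 2), ([1,4,2,3], 1), ([3,2,4,1], 4), ([1,4,2,3], 4), ([1,4,2,3,5], 5)]"
  by code_simp

lemma certificate_1432: "certificate [1,4,3,2]
    [([2,1], 2)]"
  by code_simp

lemma certificate_2134: "certificate [2,1,3,4]
    [([2,1,3], 3)]"
  by code_simp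

lemma certificate_2143: "certificate [2,1,4,3]
    [([2,3,1], 1), ([3,1,2], 3), ([1,3,2,5,4], 1), ([2,1,3,5,4], 3), ([2,1,4,3,5], 5),
     ([1,4,5,2,3], 1), ([3,4,1,2,5], 5)]"
  by code_simp

lemma certificate_2314: "certificate [2,3,1,4]
    [([2,1,3], 2), ([2,3,1,4], 4), ([4,1,3,2], 1), ([2,3,1,4], 1), ([1,3,4,2,5], 1)]"
  by code_simp

text \<open>Both \<open>[2,4,1,3]\<close> and its reverse \<open>[3,1,4,2]\<close> appear with each
  entry inflated: up to reversal, the latter amounts to inflating an entry of
  \<open>[2,4,1,3]\<close> to a decreasing run.\<close>

lemma certificate_2413: "certificate [2,4,1,3]
    [([2,4,1,3], 2), ([2,4,1,3], 4), ([2,4,1,3], 1), ([2,4,1,3], 3), ([3,1,4,2], 3),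
     ([3,1,4,2], 1), ([3,1,4,2], 4), ([3,1,4,2], 2), ([1,3,5,2,4], 1), ([2,4,1,3,5], 5),
     ([2,5,3,1,4], 3)]"
  by code_simp

lemma certificate_3124: "certificate [3,1,2,4]
    [([2,1,3], 1), ([3,1,2,4], 4), ([3,1,2,4], 3), ([4,2,1,3], 4), ([1,4,2,3,5], 1),
     ([2,5,3,1,4], 2)]"
  by code_simp

lemma certificate_3214: "certificate [3,2,1,4]
    [([2,1], 1)]"
  by code_simp

lemma certificate_exists:
  assumes "p \<in> perms 4"
  shows "\<exists>ws. certificate p ws \<or> certificate (rev p) ws"
proof -
  \<comment> \<open>The permutations whose first entry is below their last, one from each of the 12
    reversal pairs.\<close>
  define C :: "nat list set" where
    "C = {[1,2,3,4], [1,2,4,3], [1,3,2,4], [1,3,4,2], [1,4,2,3], [1,4,3,2], [2,1,3,4], [2,1,4,3],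
      [2,3,1,4], [2,4,1,3], [3,1,2,4], [3,2,1,4]}"
  have "\<forall>p \<in> permutations_of_set {1, 2, 3, 4::nat}. p \<in> C \<or> rev p \<in> C"
    unfolding C_def by code_simp
  moreover have "{1..4} = {1, 2, 3, 4::nat}" by auto
  then have "p \<in> permutations_of_set {1, 2, 3, 4}"
    using assms by (simp only:)
  ultimately have "p \<in> C \<or> rev p \<in> C" by (rule bspec)
  moreover have "\<exists>ws. certificate c ws" if "c \<in> C" for c
    using that unfolding C_def
    by (elim insertE emptyE; hypsubst)
      (rule exI, rule certificate_1234 certificate_1243 certificate_1324 certificate_1342
        certificate_1423 certificate_1432 certificate_2134 certificate_2143 certificate_2314
        certificate_2413 certificate_3124 certificate_3214)+
  ultimately show ?thesis by (elim disjE) blast+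
qed

section \<open>From certificates to legal replies\<close>

lemma separatesD:
  assumes "separates c (s, v)" "c \<in> perms 4" "l \<ge> 4"
  shows "contains (inflate s v l) c \<longleftrightarrow> \<not> contains (inflate s v l) (rev c)"
    and "s \<in> perms (length s)" "v \<in> set s" "length s \<le> 7"
proof -
  have sort: "sort s = [1..<Suc (length s)]" and "v \<in> set s" "length s \<le> 7"
    using assms(1) unfolding separates.simps by blast+
  \<comment> \<open>Sorting to consecutive numbers from 1 is the executable form of being a
    permutation.\<close>
  have "distinct (sort s)" "set (sort s) = {1..length s}"
    unfolding sort by auto
  then show s: "s \<in> perms (length s)"
    by (simp add: permutations_of_set_def)
  show v: "v \<in> set s" and "length s \<le> 7" by fact+
  have d: "distinct s" "distinct c" "length c = 4"
    using s assms(2) perms_length[of c 4] by (auto simp: permutations_of_set_def)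
  have "distinct (inflate s v 4)"
    using inflate_perms[OF s v, of 4] by (simp add: permutations_of_set_def)
  then show "contains (inflate s v l) c \<longleftrightarrow> \<not> contains (inflate s v l) (rev c)"
    using assms(1,3) d by (auto simp: inflate_contains_iff[OF d(1) v] contains_iff_comparisons)
qed

text \<open>A pattern of \<open>P\<close> occurring in the inflation would be monotone or would
  occur in \<open>\<pi>\<close> up to reversal. Both contradict that \<open>\<pi>\<close> avoids
  \<open>P\<close> and \<open>P\<close> is closed under reversal.\<close>

lemma separating_permutation:
  assumes n: "n \<ge> 10" and P: "P \<subseteq> perms 4" "rev ` P \<subseteq> P"
    and \<pi>: "\<pi> \<in> perms n" "\<And>q. q \<in> P \<Longrightarrow> avoids \<pi> q"
    and c: "c \<in> perms 4" "contains \<pi> c" "certificate c ws"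
  shows "\<exists>\<sigma>\<in>perms n. (\<forall>q\<in>P. avoids \<sigma> q) \<and> (contains \<sigma> c \<longleftrightarrow> avoids \<sigma> (rev c))"
proof -
  have \<pi>_n: "distinct \<pi>" "length \<pi> = n"
    using \<pi>(1) perms_length by (auto simp: permutations_of_set_def)
  \<comment> \<open>\<open>\<pi>\<close> contains one of the two monotone patterns; closure of
    \<open>P\<close> under reversal excludes the other as well.\<close>
  have mono: "[1,2,3,4] \<notin> P" "rev [1,2,3,4] \<notin> P"
    using contains_monotone[OF \<pi>(1) n] \<pi>(2) P(2) by force+
  obtain F where F: "F \<in> set (map inflation_types ws)" "set F \<subseteq> reversal_types \<pi>"
    using covered_if_no_survivors[of \<pi> "[c]" 4 3 c "map inflation_types ws"] \<pi>_n c n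
    by (auto simp: certificate_def)
  then obtain s v where sv: "(s, v) \<in> set ws" "F = inflation_types (s, v)" by auto
  \<comment> \<open>The total length becomes \<open>length s + ?l - 1 = n\<close>; since
    \<open>length s\<close> is at most 7 and \<open>n\<close> at least 10, the run has at least 4
    entries.\<close>
  let ?l = "n + 1 - length s"
  have sep: "separates c (s, v)"
    using c(3) sv(1) by (auto simp: certificate_def list_all_iff)
  note s = separatesD(2-4)[OF sep c(1) order.refl]
  have l: "?l \<ge> 4" using s(3) n by simp
  have d: "distinct s" using s(1) by (simp add: permutations_of_set_def)
  have "inflate s v ?l \<in> perms n"
    using inflate_perms[OF s(1,2), of ?l] s(3) n by simp
  moreover have "avoids (inflate s v ?l) q" if q: "q \<in> P" for q
  proof
    assume "contains (inflate s v ?l) q"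
    moreover have q4: "length q = 4" "distinct q"
      using q P(1) perms_length by (auto simp: permutations_of_set_def)
    ultimately obtain zs where zs: "subseq zs (inflate s v 4)" "order_isomorphic zs q"
      using inflate_contains_iff[OF d s(2) _ l] by (auto simp: contains_def)
    have z4: "length zs = 4"
      using order_isomorphic_length[OF zs(2)] q4(1) by simp
    have zd: "distinct zs"
      using zs(1) inflate_perms[OF s(1,2), of 4] subseq_distinct
      by (auto simp: permutations_of_set_def)
    show False
    proof (cases "reversal_type zs = reversal_type [1,2,3,4]")
      case True
      then have "order_isomorphic zs [1,2,3,4] \<or> order_isomorphic zs (rev [1,2,3,4])"
        using z4 zd by (intro reversal_type_eqD) auto
      then have "order_isomorphic q [1,2,3,4] \<or> order_isomorphic q (rev [1,2,3,4])"
        using zs(2) order_isomorphic_sym order_isomorphic_trans by blast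
      moreover have "[1,2,3,4] \<in> perms 4" "rev [1,2,3,4] \<in> perms 4"
        by (auto simp: permutations_of_set_def)
      ultimately have "q = [1,2,3,4] \<or> q = rev [1,2,3,4]"
        using order_isomorphic_perms_eq q P(1) by blast
      then show False using mono q by blast
    next
      case False
      then have "reversal_type zs \<in> set F"
        using zs(1) z4 unfolding sv(2) by (auto simp: set_subseqs_of_length)
      then have "contains \<pi> zs \<or> contains \<pi> (rev zs)"
        using F(2) reversal_types_containsD z4 zd by blast
      then have "contains \<pi> q \<or> contains \<pi> (rev q)"
        using zs(2) contains_order_isomorphic order_isomorphic_rev by blast
      then show False using \<pi>(2) P(2) q by blast
    qed
  qed
  ultimately show ?thesis
    using separatesD(1)[OF sep c(1) l] by blast
qed

lemma reverse_reply:
  assumes n: "n \<ge> 10" and P: "P \<subseteq> perms 4" "rev ` P \<subseteq> P"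
    and \<pi>: "\<pi> \<in> perms n" "\<And>q. q \<in> P \<Longrightarrow> avoids \<pi> q"
    and p: "p \<in> perms 4" "contains \<pi> p"
  shows "\<exists>\<sigma>\<in>perms n. (\<forall>q\<in>P. avoids \<sigma> q) \<and> avoids \<sigma> p \<and> contains \<sigma> (rev p)"
proof -
  have avoids_rev: "avoids (rev \<sigma>) q" if "\<And>q. q \<in> P \<Longrightarrow> avoids \<sigma> q" "q \<in> P" for \<sigma> q
    using that P(2) contains_rev_right[of \<sigma> q] by blast
  obtain \<sigma> where \<sigma>: "\<sigma> \<in> perms n" "\<And>q. q \<in> P \<Longrightarrow> avoids \<sigma> q"
      "contains \<sigma> p \<longleftrightarrow> avoids \<sigma> (rev p)"
  proof -
    consider ws where "certificate p ws" | ws where "certificate (rev p) ws"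
      using certificate_exists[OF p(1)] by blast
    then show thesis
    proof cases
      case 1
      then show thesis
        using separating_permutation[OF n P \<pi> p] that by blast
    next
      case 2
      \<comment> \<open>The certificate is for \<open>rev p\<close>, so it is applied to
        \<open>rev \<pi>\<close>, which contains \<open>rev p\<close> and avoids \<open>P\<close> by
        closure.\<close>
      have "\<exists>\<sigma>\<in>perms n. (\<forall>q\<in>P. avoids \<sigma> q) \<and> (contains \<sigma> (rev p) \<longleftrightarrow> avoids \<sigma> (rev (rev p)))"
      proof (rule separating_permutation[OF n P _ _ _ _ 2])
        show "rev \<pi> \<in> perms n" "rev p \<in> perms 4" "contains (rev \<pi>) (rev p)"
          using \<pi>(1) p by (simp_all only: rev_perms_iff contains_rev)
        show "avoids (rev \<pi>) q" if "q \<in> P" for q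
          using avoids_rev \<pi>(2) that by blast
      qed
      then show thesis using that by auto
    qed
  qed
  show ?thesis
  proof (cases "contains \<sigma> p")
    case False
    then show ?thesis using \<sigma> by blast
  next
    case True
    \<comment> \<open>Reversing \<open>\<sigma>\<close> exchanges the roles of \<open>p\<close> and
      \<open>rev p\<close>.\<close>
    then have "avoids (rev \<sigma>) p" "contains (rev \<sigma>) (rev p)"
      using \<sigma>(3) contains_rev_right[of \<sigma> p] contains_rev[of \<sigma> p] by blast+
    moreover have "rev \<sigma> \<in> perms n"
      using \<sigma>(1) by (simp only: rev_perms_iff)
    ultimately show ?thesis using avoids_rev \<sigma>(2) by blast
  qed
qed

theorem theorem6p12:
  fixes n :: nat
  assumes "n \<ge> 10"
  shows "reverse_strategy_winning 4 (perms n) \<and> sg 4 (perms n) = 0"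
proof -
  \<comment> \<open>\<open>P\<close> collects the patterns chosen so far; after each complete round
    it is closed under reversal.\<close>
  define I where "I X \<longleftrightarrow> (\<exists>P. P \<subseteq> perms 4 \<and> rev ` P \<subseteq> P \<and> X = {\<pi> \<in> perms n. \<forall>q\<in>P. avoids \<pi> q})"
    for X
  have "I (perms n)"
    unfolding I_def by (rule exI[of _ "{}"]) simp
  moreover have "rev p \<in> legal_moves 4 (move X p) \<and> I (move (move X p) (rev p))"
    if X: "I X" and p: "p \<in> legal_moves 4 X" for X p
  proof
    obtain P where P: "P \<subseteq> perms 4" "rev ` P \<subseteq> P" "X = {\<pi> \<in> perms n. \<forall>q\<in>P. avoids \<pi> q}"
      using X unfolding I_def by blast
    obtain \<pi> where \<pi>: "\<pi> \<in> perms n" "\<And>q. q \<in> P \<Longrightarrow> avoids \<pi> q" "p \<in> perms 4" "contains \<pi> p"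
      using p unfolding P(3) legal_moves_def by blast
    obtain \<sigma> where "\<sigma> \<in> X" "avoids \<sigma> p" "contains \<sigma> (rev p)"
      using reverse_reply[OF assms P(1,2) \<pi>] unfolding P(3) by blast
    then show "rev p \<in> legal_moves 4 (move X p)"
      using \<pi>(3) rev_perms_iff unfolding legal_moves_def move_def by blast
    have "insert p (insert (rev p) P) \<subseteq> perms 4"
      using P(1) \<pi>(3) rev_perms_iff by blast
    moreover have "rev ` insert p (insert (rev p) P) \<subseteq> insert p (insert (rev p) P)"
      using P(2) by auto
    moreover have "move (move X p) (rev p) =
        {\<pi> \<in> perms n. \<forall>q\<in>insert p (insert (rev p) P). avoids \<pi> q}"
      unfolding move_def P(3) by blast
    ultimately show "I (move (move X p) (rev p))"
      unfolding I_def by blast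
  qed
  ultimately show ?thesis
    using reverse_strategy_winning_if_replies[of I] sg_eq_0_if_replies[of I "perms n" 4 rev] by blast
qed

end
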